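(* For each integer $d\ge1$ the generic $f\in\mathrm{Homeo}([0,1]^d)$ is singular; that is, the set of singular $f\in\mathrm{Homeo}([0,1]^d)$ is co-meager in $\mathrm{Homeo}([0,1]^d)$.
   Context: $\mathrm{Homeo}([0,1]^d)$ is the group of homeomorphisms of $[0,1]^d$ with the topology of the maximum metric $\max_x|f(x)-g(x)|$; this topology is completely metrizable. A set is meager if it is a countable union of nowhere dense sets, and co-meager if its complement is meager. $\lambda^d$ denotes $d$-dimensional Lebesgue measure. A homeomorphism $f\in\mathrm{Homeo}([0,1]^d)$ is singular if there exists a Borel set $F\subseteq[0,1]^d$ with $\lambda^d(F)=1$ and $\lambda^d(f(F))=0$. *)

theory Defs
  imports "HOL-Analysis.Analysis"
begin

definition nowhere_dense_in :: "'a topology \<Rightarrow> 'a set \<Rightarrow> bool"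
  where "nowhere_dense_in X S \<longleftrightarrow>
    S \<subseteq> topspace X \<and> X interior_of (X closure_of S) = {}"

definition meager_in :: "'a topology \<Rightarrow> 'a set \<Rightarrow> bool"
  where "meager_in X S \<longleftrightarrow>
    (\<exists>N :: nat \<Rightarrow> 'a set. (\<forall>n. nowhere_dense_in X (N n)) \<and> S = (\<Union>n. N n))"

definition comeager_in :: "'a topology \<Rightarrow> 'a set \<Rightarrow> bool"
  where "comeager_in X S \<longleftrightarrow> S \<subseteq> topspace X \<and> meager_in X (topspace X - S)"

definition unit_cube :: "(real^'n) set"
  where "unit_cube = cbox 0 1"

text \<open>The metric space of homeomorphisms of the cube onto itself with the uniform metric. As in
  \<^const>\<open>cfunspace\<close>, a map of the cube is represented by the total function that agrees with it on
  the cube and is \<^const>\<open>undefined\<close> elsewhere.\<close>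

definition homeo_cube :: "(real^'n \<Rightarrow> real^'n) metric"
  where "homeo_cube =
    submetric (cfunspace (top_of_set unit_cube) euclidean_metric)
      {f. \<exists>g. homeomorphism unit_cube unit_cube f g}"

lemma mspace_homeo_cube:
  "mspace (homeo_cube :: (real^'n \<Rightarrow> real^'n) metric) =
    {f \<in> extensional unit_cube. \<exists>g. homeomorphism unit_cube unit_cube f g}"
proof -
  have "compact (unit_cube :: (real^'n) set)"
    by (simp add: unit_cube_def)
  then have "mspace (cfunspace (top_of_set unit_cube) euclidean_metric) =
      {f :: real^'n \<Rightarrow> real^'n. f \<in> extensional unit_cube \<and> continuous_on unit_cube f}"
    by (subst compactin_mspace_cfunspace) (simp_all add: compactin_subtopology)
  then show ?thesis
    unfolding homeo_cube_def mspace_submetric using homeomorphism_cont1 by blast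
qed

text \<open>By compactness the supremum is a maximum.\<close>

lemma mdist_homeo_cube:
  fixes f g :: "real^'n \<Rightarrow> real^'n"
  assumes "f \<in> mspace homeo_cube" "g \<in> mspace homeo_cube"
  obtains x where "x \<in> unit_cube" "mdist homeo_cube f g = dist (f x) (g x)"
    "\<And>y. y \<in> unit_cube \<Longrightarrow> dist (f y) (g y) \<le> dist (f x) (g x)"
proof -
  have "continuous_on unit_cube f" "continuous_on unit_cube g"
    using assms by (auto simp: mspace_homeo_cube homeomorphism_def)
  then have "continuous_on unit_cube (\<lambda>x. dist (f x) (g x))"
    by (intro continuous_intros)
  moreover have "compact (unit_cube :: (real^'n) set)"
    by (simp add: unit_cube_def)
  moreover have ne: "(unit_cube :: (real^'n) set) \<noteq> {}"
  proof -
    have "(0 :: real^'n) \<in> unit_cube"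
      by (simp add: unit_cube_def mem_box_cart)
    then show ?thesis by blast
  qed
  ultimately obtain x where x: "x \<in> unit_cube"
    "\<And>y. y \<in> unit_cube \<Longrightarrow> dist (f y) (g y) \<le> dist (f x) (g x)"
    using continuous_attains_sup[of unit_cube "\<lambda>x. dist (f x) (g x)"] by blast
  have fg: "f \<in> mspace (cfunspace (top_of_set unit_cube) euclidean_metric)"
    "g \<in> mspace (cfunspace (top_of_set unit_cube) euclidean_metric)"
    using assms unfolding homeo_cube_def mspace_submetric by blast+
  have "mdist homeo_cube f g \<le> a \<longleftrightarrow> (\<forall>y\<in>unit_cube. dist (f y) (g y) \<le> a)" for a
    using cfunspace_mdist_le[OF fg, of a] ne by (simp add: homeo_cube_def)
  then have "mdist homeo_cube f g \<le> a \<longleftrightarrow> dist (f x) (g x) \<le> a" for a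
    using x by (meson order.trans)
  then have "mdist homeo_cube f g = dist (f x) (g x)"
    by (meson order.antisym order.refl)
  with x that show thesis by blast
qed

definition singular_homeo :: "(real^'n \<Rightarrow> real^'n) \<Rightarrow> bool"
  where "singular_homeo f \<longleftrightarrow> f \<in> mspace homeo_cube \<and>
    (\<exists>F. F \<in> sets borel \<and> F \<subseteq> unit_cube \<and>
      emeasure lborel F = 1 \<and> emeasure lborel (f ` F) = 0)"

text \<open>The image of \<open>F\<close> above is automatically Borel, so the last condition does not hold merely
  because \<^const>\<open>emeasure\<close> is 0 outside the measurable sets.\<close>

lemma borel_image_homeo_cube:
  fixes f :: "real^'n \<Rightarrow> real^'n"
  assumes "f \<in> mspace homeo_cube" "F \<in> sets borel" "F \<subseteq> unit_cube"
  shows "f ` F \<in> sets borel"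
proof -
  obtain g where h: "homeomorphism unit_cube unit_cube f g"
    using assms(1) by (auto simp: mspace_homeo_cube)
  have K: "unit_cube \<in> sets (borel :: (real^'n) measure)"
    by (simp add: unit_cube_def)
  have "f ` F = g -` F \<inter> unit_cube"
  proof (intro set_eqI iffI)
    fix y assume "y \<in> f ` F"
    then obtain x where "x \<in> F" "y = f x" by blast
    with assms(3) show "y \<in> g -` F \<inter> unit_cube"
      using homeomorphism_apply1[OF h] homeomorphism_image1[OF h] by auto
  next
    fix y assume "y \<in> g -` F \<inter> unit_cube"
    then show "y \<in> f ` F"
      using homeomorphism_apply2[OF h] by (metis IntE image_eqI vimageE)
  qed
  moreover have "g \<in> borel_measurable (restrict_space borel unit_cube)"
    by (intro borel_measurable_continuous_on_restrict homeomorphism_cont2[OF h])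
  then have "g -` F \<inter> unit_cube \<in> sets (restrict_space borel unit_cube)"
    using measurable_sets[OF _ assms(2), of g "restrict_space borel unit_cube"]
    by (simp add: space_restrict_space)
  ultimately show ?thesis
    using K by (simp add: sets_restrict_space_iff)
qed

end

theory Submission
  imports Defs
begin

text \<open>The homeomorphisms \<open>f\<close> admitting a compact \<open>K\<close> with \<open>\<lambda>(K) > 1 - \<epsilon>\<close> and \<open>\<lambda>(f(K)) < \<epsilon>\<close> form
  an open set, by outer regularity at the compact set \<open>f(K)\<close>, and by Borel-Cantelli \<open>f\<close> is singular
  if it lies in these sets for all \<open>\<epsilon> = 1 / 2\<^sup>n\<close>. For density, compose \<open>f\<close> with a homeomorphism that
  moves a single coordinate by a function close to the identity whose increments are concentrated
  on short intervals. The preimage under \<open>f\<close> of the slabs over these intervals is small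
  for a suitable choice among disjoint families of intervals, and off the slabs the coordinate is
  squeezed into a set of small measure. Only the projection of the measure to one coordinate
  matters, so no control of \<open>f\<close> at the faces of cubes is needed.\<close>

section \<open>The dense open set criterion for comeagerness\<close>

lemma comeager_inI:
  fixes U :: "nat \<Rightarrow> 'a set"
  assumes "\<And>n. openin X (U n)" "\<And>n. X closure_of (U n) = topspace X"
    and "(\<Inter>n. U n) \<subseteq> S" "S \<subseteq> topspace X"
  shows "comeager_in X S"
proof -
  \<comment> \<open>\<open>meager_in\<close> asks for an exact union, so the pieces are trimmed to
    \<open>topspace X - S\<close>. Each lies in the closed set \<open>topspace X - U n\<close>,
    whose interior is empty because \<open>U n\<close> is dense.\<close>
  have "nowhere_dense_in X (topspace X - S - U n)" for n
  proof -
    have "closedin X (topspace X - U n)"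
      using assms(1) by blast
    then have "X closure_of (topspace X - S - U n) \<subseteq> topspace X - U n"
      by (intro closure_of_minimal) auto
    then have "X interior_of (X closure_of (topspace X - S - U n)) \<subseteq> X interior_of (topspace X - U n)"
      by (rule interior_of_mono)
    then show ?thesis
      using assms(2) by (auto simp: nowhere_dense_in_def interior_of_complement)
  qed
  moreover have "topspace X - S = (\<Union>n. topspace X - S - U n)"
    using assms(3) by auto
  ultimately show ?thesis
    using assms(4) unfolding comeager_in_def meager_in_def
    by (intro conjI exI[of _ "\<lambda>n. topspace X - S - U n"]) auto
qed

section \<open>Compactness and measure on the cube\<close>

lemma mem_unit_cube: "x \<in> unit_cube \<longleftrightarrow> (\<forall>i. 0 \<le> x $ i \<and> x $ i \<le> 1)"
  by (auto simp: unit_cube_def mem_box_cart)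

lemma compact_unit_cube: "compact unit_cube"
  by (simp add: unit_cube_def)

lemma measure_unit_cube: "measure lborel (unit_cube :: (real^'n) set) = 1"
proof -
  have "cbox 0 (1 :: real^'n) \<noteq> {}"
    using mem_unit_cube[of "0 :: real^'n"] unfolding unit_cube_def by force
  then show ?thesis
    by (simp add: unit_cube_def content_cbox_cart)
qed

lemma borel_unit_cube: "unit_cube \<in> sets borel"
  by (simp add: borel_compact compact_unit_cube)

lemma fmeasurable_unit_cube_subset:
  "A \<in> sets borel \<Longrightarrow> A \<subseteq> unit_cube \<Longrightarrow> A \<in> fmeasurable lborel"
  by (rule fmeasurableI2[OF fmeasurable_compact[OF compact_unit_cube]]) auto

lemma homeo_cube_props:
  assumes "f \<in> mspace homeo_cube"
  shows "continuous_on unit_cube f" "f ` unit_cube = unit_cube"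
  using assms by (auto simp: mspace_homeo_cube homeomorphism_def)

lemma compact_image_homeo_cube:
  assumes "f \<in> mspace homeo_cube" "compact K" "K \<subseteq> unit_cube"
  shows "compact (f ` K)"
  using assms homeo_cube_props(1) by (meson compact_continuous_image continuous_on_subset)

lemma dist_le_mdist_homeo_cube:
  assumes "f \<in> mspace homeo_cube" "g \<in> mspace homeo_cube" "x \<in> unit_cube"
  shows "dist (f x) (g x) \<le> mdist homeo_cube f g"
  using mdist_homeo_cube[OF assms(1,2)] assms(3) by metis

section \<open>Openness of near singularity\<close>

lemma openin_mtopology_of:
  "openin (mtopology_of m) U \<longleftrightarrow>
    U \<subseteq> mspace m \<and> (\<forall>x\<in>U. \<exists>r>0. \<forall>y\<in>mspace m. mdist m x y < r \<longrightarrow> y \<in> U)"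
proof -
  interpret Metric_space "mspace m" "mdist m"
    by (rule Metric_space_mspace_mdist)
  show ?thesis
    unfolding mtopology_of_def openin_mtopology subset_iff in_mball by blast
qed

text \<open>\<open>K\<close> is compact rather than merely Borel so that f(K) is compact too, and a
  small uniform perturbation of f keeps it inside a given open neighbourhood.\<close>

definition nearly_singular :: "real \<Rightarrow> (real^'n \<Rightarrow> real^'n) set"
  where "nearly_singular e = {f \<in> mspace homeo_cube. \<exists>K. compact K \<and> K \<subseteq> unit_cube \<and>
    measure lborel (unit_cube - K) < e \<and> measure lborel (f ` K) < e}"

lemma openin_nearly_singular:
  "openin (mtopology_of homeo_cube) (nearly_singular e :: (real^'n \<Rightarrow> real^'n) set)"
  unfolding openin_mtopology_of
proof (intro conjI ballI)
  show "(nearly_singular e :: (real^'n \<Rightarrow> real^'n) set) \<subseteq> mspace homeo_cube"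
    by (auto simp: nearly_singular_def)
next
  fix f :: "real^'n \<Rightarrow> real^'n"
  assume "f \<in> nearly_singular e"
  then obtain K where f: "f \<in> mspace homeo_cube" and K: "compact K" "K \<subseteq> unit_cube"
    "measure lborel (unit_cube - K) < e" and fK: "measure lborel (f ` K) < e"
    unfolding nearly_singular_def by blast
  have cpt: "compact (f ` K)"
    using compact_image_homeo_cube f K by blast
  obtain U where U: "open U" "f ` K \<subseteq> U"
    "emeasure lborel (U - f ` K) < ennreal (e - measure lborel (f ` K))"
    using outer_regular_lborel[OF borel_compact[OF cpt]] fK by (metis diff_gt_0_iff_gt)
  \<comment> \<open>\<open>measure\<close> is 0 on sets of infinite measure, so finiteness is
    secured before passing from \<open>emeasure\<close> to \<open>measure\<close>.\<close>
  have fm: "U - f ` K \<in> fmeasurable lborel"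
    using U(1,3) cpt
    by (intro fmeasurableI) (auto simp: borel_compact intro: order_less_trans[OF _ ennreal_less_top])
  then have "measure lborel (U - f ` K) < e - measure lborel (f ` K)"
    using U(3) fK by (simp add: emeasure_eq_measure2 ennreal_less_iff)
  moreover have "U = f ` K \<union> (U - f ` K)"
    using U(2) by blast
  then have "U \<in> fmeasurable lborel" "measure lborel U \<le> measure lborel (f ` K) + measure lborel (U - f ` K)"
    using fmeasurable.Un[OF fmeasurable_compact[OF cpt] fm]
      measure_Un_le[of "f ` K" lborel "U - f ` K"] fm cpt by (auto simp: borel_compact fmeasurableD)
  ultimately have Ue: "U \<in> fmeasurable lborel" "measure lborel U < e"
    by auto
  \<comment> \<open>Compactness gives one radius for all points of f(K); hence every g within
    \<open>r\<close> of f still maps \<open>K\<close> into \<open>U\<close>.\<close>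
  obtain r where r: "r > 0" "(\<Union>y\<in>f ` K. ball y r) \<subseteq> U"
    using compact_subset_open_imp_ball_epsilon_subset[OF cpt U(1,2)] by blast
  have "g \<in> nearly_singular e" if g: "g \<in> mspace homeo_cube" "mdist homeo_cube f g < r" for g
  proof -
    have "g ` K \<subseteq> U"
    proof clarify
      fix x assume "x \<in> K"
      then have "dist (f x) (g x) < r"
        using dist_le_mdist_homeo_cube[OF f g(1), of x] K(2) g(2) by force
      then have "g x \<in> (\<Union>y\<in>f ` K. ball y r)"
        using \<open>x \<in> K\<close> by auto
      with r(2) show "g x \<in> U"
        by blast
    qed
    then have "measure lborel (g ` K) \<le> measure lborel U"
      using compact_image_homeo_cube[OF g(1) K(1,2)] Ue(1)
      by (intro measure_mono_fmeasurable) (auto simp: borel_compact)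
    then show ?thesis
      using g(1) K Ue(2) unfolding nearly_singular_def by force
  qed
  then show "\<exists>r>0. \<forall>g\<in>mspace homeo_cube. mdist homeo_cube f g < r \<longrightarrow> g \<in> nearly_singular e"
    using r(1) by blast
qed

section \<open>Passage to the limit by Borel-Cantelli\<close>

lemma singular_homeo_if_nearly_singular:
  fixes f :: "real^'n \<Rightarrow> real^'n"
  assumes "\<And>n. f \<in> nearly_singular ((1/2) ^ n)"
  shows "singular_homeo f"
proof -
  have f: "f \<in> mspace homeo_cube"
    using assms[of 0] by (simp add: nearly_singular_def)
  obtain K where K: "\<And>n. compact (K n)" "\<And>n. K n \<subseteq> unit_cube"
    "\<And>n. measure lborel (unit_cube - K n) < (1/2) ^ n" "\<And>n. measure lborel (f ` K n) < (1/2) ^ n"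
    using assms unfolding nearly_singular_def by simp metis
  \<comment> \<open>Used twice: for the complements of the \<open>K n\<close> in the cube and for
    their images.\<close>
  have null: "limsup A \<in> null_sets lborel"
    if "\<And>n. A n \<in> sets borel" "\<And>n. A n \<subseteq> unit_cube" "\<And>n. measure lborel (A n) < (1/2) ^ n"
    for A :: "nat \<Rightarrow> (real^'n) set"
  proof (rule borel_cantelli_limsup1)
    show "emeasure lborel (A n) < \<infinity>" for n
      using fmeasurable_unit_cube_subset[OF that(1,2)] by (simp add: fmeasurable_def)
    show "summable (\<lambda>n. measure lborel (A n))"
      by (rule summable_comparison_test'[of "\<lambda>n. (1/2) ^ n" 0])
        (auto simp: that(3) less_imp_le)
  qed (simp add: that)
  \<comment> \<open>The limit superior of the \<open>K n\<close>. A point of the cube outside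
    \<open>F\<close> misses \<open>K n\<close> from some n on, and f sends \<open>F\<close> into the
    limit superior of the images, so \<open>null\<close> applies on both sides.\<close>
  define F where "F = (\<Inter>m. \<Union>n\<in>{m..}. K n)"
  have "F \<subseteq> (\<Union>n\<in>{0..}. K n)"
    unfolding F_def by (rule INF_lower) simp
  then have F: "F \<subseteq> unit_cube" "F \<in> sets borel"
    using K(1,2) by (auto simp: F_def borel_compact intro!: sets.countable_INT sets.countable_UN)
  \<comment> \<open>If x misses \<open>K n\<close> for all n \<ge> m, then for any m' the index max
    m m' shows that x lies in some later complement.\<close>
  have "unit_cube - F \<subseteq> limsup (\<lambda>n. unit_cube - K n)"
    unfolding F_def limsup_INF_SUP by (auto intro: max.cobounded1 max.cobounded2)
  moreover have "limsup (\<lambda>n. unit_cube - K n) \<in> null_sets lborel"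
    using K by (intro null) (auto simp: borel_compact borel_unit_cube)
  ultimately have "unit_cube - F \<in> null_sets lborel"
    using F borel_unit_cube by (intro null_sets_subset[of _ lborel "unit_cube - F"]) auto
  then have "emeasure lborel (unit_cube - (unit_cube - F)) = emeasure lborel (unit_cube :: (real^'n) set)"
    by (rule emeasure_Diff_null_set) (simp add: borel_unit_cube)
  moreover have "unit_cube - (unit_cube - F) = F"
    using F(1) by blast
  moreover have "emeasure lborel (unit_cube :: (real^'n) set) = 1"
    using measure_unit_cube
    by (simp add: emeasure_eq_measure2[OF fmeasurable_compact[OF compact_unit_cube]])
  ultimately have "emeasure lborel F = 1"
    by simp
  moreover have "f ` F \<subseteq> limsup (\<lambda>n. f ` K n)"
    unfolding F_def limsup_INF_SUP by fastforce
  moreover have "limsup (\<lambda>n. f ` K n) \<in> null_sets lborel"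
  proof (intro null)
    show "f ` K n \<in> sets borel" for n
      using K by (simp add: borel_compact compact_image_homeo_cube[OF f])
    show "f ` K n \<subseteq> unit_cube" for n
      using image_mono[OF K(2), of f n] homeo_cube_props(2)[OF f] by simp
  qed (rule K)
  ultimately have "emeasure lborel F = 1" "emeasure lborel (f ` F) = 0"
    using borel_image_homeo_cube[OF f F(2,1)] null_sets_subset[of _ lborel "f ` F"] by auto
  with f F show ?thesis
    unfolding singular_homeo_def by blast
qed

section \<open>Staircase functions close to the identity\<close>

text \<open>For \<open>k < M\<close>, \<open>stair N M k\<close> rises by \<open>1 / N\<close> on each interval
  \<open>[(M i + k) / (M N), (M i + k + 1) / (M N)]\<close> with \<open>i < N\<close> and is constant in between.\<close>

definition stair :: "nat \<Rightarrow> nat \<Rightarrow> nat \<Rightarrow> real \<Rightarrow> real"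
  where "stair N M k t = (\<Sum>i<N. max 0 (min 1 (real M * real N * t - real (M * i + k)))) / real N"

lemma continuous_on_stair [continuous_intros]:
  "continuous_on S h \<Longrightarrow> continuous_on S (\<lambda>x. stair N M k (h x))"
  \<comment> \<open>For \<open>N = 0\<close> division by zero makes the function constantly 0;
    otherwise the denominator is a nonzero constant.\<close>
  unfolding stair_def by (cases "N = 0") (auto intro!: continuous_intros)

lemma stair_mono:
  assumes "s \<le> t"
  shows "stair N M k s \<le> stair N M k t"
proof -
  have "real M * real N * s \<le> real M * real N * t"
    using assms by (intro mult_left_mono) auto
  then show ?thesis
    unfolding stair_def by (intro divide_right_mono sum_mono) auto
qed

text \<open>Let j be the integer part of N t. At t the steps before the j-th are complete and those
  after it have not begun, so N times the staircase lies in [j, j + 1], as does N t.\<close>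

lemma stair_near:
  assumes "N > 0" "k < M" "0 \<le> t" "t \<le> 1"
  shows "\<bar>stair N M k t - t\<bar> \<le> 1 / real N"
proof -
  define j where "j = nat \<lfloor>real N * t\<rfloor>"
  have j: "real j \<le> real N * t" "real N * t < real j + 1"
    using assms unfolding j_def by (auto simp: of_nat_nat)
  have "real N * t \<le> real N"
    using assms by (simp add: mult_left_le)
  with j have jN: "j \<le> N"
    by linarith
  define c where "c i = max 0 (min 1 (real M * real N * t - real (M * i + k)))" for i
  have c0: "of_bool (i < j) \<le> c i" for i
  proof (cases "i < j")
    case True
    then have "real M * (real i + 1) \<le> real M * (real N * t)"
      using j by (intro mult_left_mono) auto
    then have "1 \<le> real M * real N * t - real (M * i + k)"
      using assms(2) by (simp add: algebra_simps)
    with True show ?thesis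
      by (simp add: c_def)
  qed (simp add: c_def)
  have c1: "c i \<le> of_bool (i < Suc j)" for i
  proof (cases "i < Suc j")
    case False
    then have "real M * (real N * t) \<le> real M * real i"
      using j by (intro mult_left_mono) auto
    then have "real M * real N * t - real (M * i + k) \<le> 0"
      by (simp add: algebra_simps)
    with False show ?thesis
      by (simp add: c_def)
  qed (simp add: c_def)
  \<comment> \<open>The minimum matters at t = 1: there j = N, and the upper count is N instead of j
    + 1.\<close>
  have count: "(\<Sum>i<N. of_bool (i < l)) = real (min N l)" for l
  proof -
    have "{..<N} \<inter> {i. i < l} = {..<min N l}"
      by auto
    then show ?thesis
      by (simp add: sum.If_cases of_bool_def)
  qed
  have "(\<Sum>i<N. of_bool (i < j)) \<le> (\<Sum>i<N. c i)" "(\<Sum>i<N. c i) \<le> (\<Sum>i<N. of_bool (i < Suc j))"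
    by (intro sum_mono c0 c1)+
  then have "real j \<le> (\<Sum>i<N. c i)" "(\<Sum>i<N. c i) \<le> real j + 1"
    using jN by (auto simp: count)
  with j have "\<bar>(\<Sum>i<N. c i) - real N * t\<bar> \<le> 1"
    by linarith
  moreover have "stair N M k t - t = ((\<Sum>i<N. c i) - real N * t) / real N"
    using assms(1) by (simp add: stair_def c_def field_simps)
  ultimately show ?thesis
    by (simp add: divide_right_mono)
qed

lemma stair_0: "stair N M k 0 = 0"
proof -
  have "max 0 (min 1 (real M * real N * 0 - real (M * i + k))) = 0" for i
    using of_nat_0_le_iff[of "M * i + k", where 'a = real] by linarith
  then show ?thesis
    by (simp add: stair_def)
qed

lemma stair_1:
  assumes "N > 0" "k < M"
  shows "stair N M k 1 = 1"
proof -
  have "1 \<le> real M * real N - real (M * i + k)" if "i < N" for i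
  proof -
    have "M * i + k + 1 \<le> M * (i + 1)"
      using assms by simp
    also have "\<dots> \<le> M * N"
      using that by (intro mult_le_mono) auto
    finally have "real (M * i + k + 1) \<le> real (M * N)"
      by (rule of_nat_mono)
    then show ?thesis
      by simp
  qed
  then have "(\<Sum>i<N. max 0 (min 1 (real M * real N * 1 - real (M * i + k)))) = (\<Sum>i<N. 1)"
    by (intro sum.cong) auto
  with assms show ?thesis
    by (simp add: stair_def)
qed

section \<open>Homeomorphisms moving one coordinate\<close>

text \<open>A continuous bijection between compact Hausdorff spaces has a continuous inverse.
  Surjectivity comes from the intermediate value theorem, injectivity from strict
  monotonicity.\<close>

lemma homeomorphism_unit_cube_coordinate:
  fixes a :: "'n::finite" and h :: "real \<Rightarrow> real"
  assumes h: "continuous_on {0..1} h" "strict_mono_on {0..1} h" "h 0 = 0" "h 1 = 1"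
  shows "\<exists>g. homeomorphism unit_cube unit_cube
    (\<lambda>y :: real^'n. \<chi> i. if i = a then h (y $ a) else y $ i) g" (is "\<exists>g. homeomorphism _ _ ?H g")
proof (rule homeomorphism_compact[OF compact_unit_cube])
  have "continuous_on unit_cube (\<lambda>y :: real^'n. h (y $ a))"
    by (rule continuous_on_compose2[OF h(1)]) (auto intro!: continuous_intros simp: mem_unit_cube)
  then have "continuous_on unit_cube (\<lambda>y :: real^'n. if i = a then h (y $ a) else y $ i)" for i
    by (cases "i = a") (auto intro!: continuous_intros)
  then show "continuous_on unit_cube ?H"
    by (rule continuous_on_vec_lambda)
  have h01: "0 \<le> h t" "h t \<le> 1" if "0 \<le> t" "t \<le> 1" for t
    using strict_mono_on_leD[OF h(2), of 0 t] strict_mono_on_leD[OF h(2), of t 1] that h(3,4) by auto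
  show "?H ` unit_cube = unit_cube"
  proof (intro equalityI subsetI)
    fix z assume "z \<in> ?H ` unit_cube"
    then show "z \<in> unit_cube"
      using h01 by (auto simp: mem_unit_cube)
  next
    fix z :: "real^'n" assume z: "z \<in> unit_cube"
    obtain t where t: "0 \<le> t" "t \<le> 1" "h t = z $ a"
      using IVT'[of h 0 "z $ a" 1] h z by (auto simp: mem_unit_cube)
    then have "z = ?H (\<chi> i. if i = a then t else z $ i)"
      by (simp add: vec_eq_iff)
    moreover have "(\<chi> i. if i = a then t else z $ i) \<in> unit_cube"
      using z t by (auto simp: mem_unit_cube)
    ultimately show "z \<in> ?H ` unit_cube"
      by blast
  qed
  show "inj_on ?H unit_cube"
  proof (rule inj_onI)
    fix x y :: "real^'n"
    assume xy: "x \<in> unit_cube" "y \<in> unit_cube" "?H x = ?H y"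
    have "(if i = a then h (x $ a) else x $ i) = (if i = a then h (y $ a) else y $ i)" for i
      using xy(3) by (simp add: vec_eq_iff)
    then have "h (x $ a) = h (y $ a)" "\<And>i. i \<noteq> a \<Longrightarrow> x $ i = y $ i"
      by (metis (full_types))+
    moreover from this have "x $ a = y $ a"
      using strict_mono_on_imp_inj_on[OF h(2)] xy(1,2) by (auto simp: inj_on_def mem_unit_cube)
    ultimately show "x = y"
      by (metis vec_eq_iff)
  qed
qed

section \<open>Slabs, and the points off the steps\<close>

lemma measure_slab_le:
  fixes a :: "'n::finite"
  assumes "0 \<le> w"
  shows "measure lborel (cbox (\<chi> i. if i = a then u else 0) (\<chi> i. if i = a then u + w else 1) :: (real^'n) set) \<le> w"
  using assms by (simp add: content_cbox_if_cart if_distrib prod.delta cong: if_cong)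

text \<open>For positive \<open>M\<close> and \<open>N\<close>, the complement of the open rising
  intervals of \<open>stair N M k\<close>, scaled by \<open>M * N\<close> to avoid division. Keeping
  the endpoints makes it closed, so that its preimage in the cube is compact.\<close>

definition off_steps :: "nat \<Rightarrow> nat \<Rightarrow> nat \<Rightarrow> real set"
  where "off_steps N M k = {t. \<forall>i<N. real M * real N * t \<le> real (M * i + k) \<or>
    real (M * i + k) + 1 \<le> real M * real N * t}"

text \<open>Off the steps every summand is 0 or 1, so the sum counts the completed steps.\<close>

lemma stair_off_steps:
  assumes "t \<in> off_steps N M k"
  obtains j where "j \<le> N" "stair N M k t = real j / real N"
proof -
  let ?P = "\<lambda>i. real (M * i + k) + 1 \<le> real M * real N * t"
  have "(\<Sum>i<N. max 0 (min 1 (real M * real N * t - real (M * i + k)))) = (\<Sum>i<N. of_bool (?P i))"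
  proof (rule sum.cong)
    fix i assume "i \<in> {..<N}"
    then have "real M * real N * t \<le> real (M * i + k) \<or> ?P i"
      using assms by (simp add: off_steps_def)
    then show "max 0 (min 1 (real M * real N * t - real (M * i + k))) = of_bool (?P i)"
      by auto
  qed simp
  also have "\<dots> = real (card ({..<N} \<inter> Collect ?P))"
    by (simp add: sum.If_cases of_bool_def)
  finally show thesis
    using that[of "card ({..<N} \<inter> Collect ?P)"] card_mono[of "{..<N}" "{..<N} \<inter> Collect ?P"]
    by (simp add: stair_def)
qed

lemma closed_off_steps: "closed (off_steps N M k)"
  unfolding off_steps_def
  by (intro closed_Collect_all closed_Collect_imp closed_Collect_disj closed_Collect_le
      continuous_intros) auto

text \<open>A common point would put M N t in two open unit intervals with integer left ends. The
  ends then agree, and reduction modulo \<open>M\<close> gives \<open>k = l\<close>.\<close>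

lemma disjnt_Compl_off_steps:
  assumes "k < M" "l < M" "k \<noteq> l"
  shows "disjnt (- off_steps N M k) (- off_steps N M l)"
proof (rule ccontr)
  assume "\<not> ?thesis"
  then obtain t where "t \<notin> off_steps N M k" "t \<notin> off_steps N M l"
    by (auto simp: disjnt_iff)
  then obtain i j where
    "real (M * i + k) < real M * real N * t" "real M * real N * t < real (M * i + k) + 1"
    "real (M * j + l) < real M * real N * t" "real M * real N * t < real (M * j + l) + 1"
    unfolding off_steps_def mem_Collect_eq not_all not_imp de_Morgan_disj not_le by blast
  then have "M * i + k = M * j + l"
    by linarith
  then have "(M * i + k) mod M = (M * j + l) mod M"
    by simp
  with assms show False
    by simp
qed

text \<open>Pigeonhole: the \<open>M\<close> families of steps are disjoint.\<close>

lemma exists_small_steps: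
  fixes p :: "real^'n \<Rightarrow> real"
  assumes p: "continuous_on unit_cube p" and M: "0 < M"
  obtains k where "k < M" "compact (unit_cube \<inter> p -` off_steps N M k)"
    "measure lborel (unit_cube - p -` off_steps N M k) \<le> 1 / real M"
proof -
  have cpt: "compact (unit_cube \<inter> p -` off_steps N M k)" for k
  proof -
    have "closed (unit_cube \<inter> p -` off_steps N M k)"
      using p compact_imp_closed[OF compact_unit_cube] closed_off_steps
      by (rule continuous_closed_preimage)
    from compact_Int_closed[OF compact_unit_cube this] show ?thesis
      by (simp add: Int_assoc[symmetric])
  qed
  define E where "E k = unit_cube - p -` off_steps N M k" for k
  \<comment> \<open>\<open>p\<close> is controlled only on the cube, so measurability is read off
    from a difference of two compact sets.\<close>
  have "E k = unit_cube - (unit_cube \<inter> p -` off_steps N M k)" for k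
    by (auto simp: E_def)
  then have borel: "E k \<in> sets borel" for k
    using sets.Diff[OF borel_unit_cube borel_compact[OF cpt]] by simp
  have fm: "E k \<in> fmeasurable lborel" for k
    by (rule fmeasurable_unit_cube_subset[OF borel]) (auto simp: E_def)
  have "pairwise (\<lambda>k l. disjnt (E k) (E l)) {..<M}"
    using disjnt_Compl_off_steps[of _ M _ N] unfolding pairwise_def E_def disjnt_iff by auto
  then have "(\<Sum>k<M. measure lborel (E k)) = measure lborel (\<Union>k<M. E k)"
    using fm by (intro measure_UNION'[symmetric]) auto
  also have "\<dots> \<le> measure lborel (unit_cube :: (real^'n) set)"
  proof (rule measure_mono_fmeasurable)
    show "(\<Union>k<M. E k) \<in> sets lborel"
      using borel by (intro sets.finite_UN) auto
  qed (auto simp: E_def fmeasurable_compact compact_unit_cube)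
  finally have sum: "(\<Sum>k<M. measure lborel (E k)) \<le> 1"
    by (simp add: measure_unit_cube)
  have "\<exists>k<M. measure lborel (E k) \<le> 1 / real M"
  proof (rule ccontr)
    assume "\<not> ?thesis"
    then have "(\<Sum>k<M. 1 / real M) < (\<Sum>k<M. measure lborel (E k))"
      using M by (intro sum_strict_mono) auto
    with sum M show False
      by simp
  qed
  with that cpt show thesis
    by (auto simp: E_def)
qed

section \<open>Density of near singularity\<close>

lemma restrict_compose_homeo_cube:
  assumes "f \<in> mspace homeo_cube" "homeomorphism unit_cube unit_cube H H'"
  shows "restrict (H \<circ> f) unit_cube \<in> mspace homeo_cube"
proof -
  obtain f' where "homeomorphism unit_cube unit_cube f f'"
    using assms(1) by (auto simp: mspace_homeo_cube)
  then have "homeomorphism unit_cube unit_cube (H \<circ> f) (f' \<circ> H')"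
    using assms(2) by (rule homeomorphism_compose)
  then have "homeomorphism unit_cube unit_cube (restrict (H \<circ> f) unit_cube) (f' \<circ> H')"
    by (rule homeomorphism_cong) auto
  then show ?thesis
    by (auto simp: mspace_homeo_cube)
qed

lemma closure_of_nearly_singular:
  assumes "0 < e"
  shows "mtopology_of homeo_cube closure_of (nearly_singular e :: (real^'n \<Rightarrow> real^'n) set) =
    topspace (mtopology_of homeo_cube)"
  unfolding dense_intersects_open
proof (intro allI impI, elim conjE)
  fix T :: "(real^'n \<Rightarrow> real^'n) set"
  assume T: "openin (mtopology_of homeo_cube) T" "T \<noteq> {}"
  then obtain f r where f: "f \<in> mspace homeo_cube" and r: "0 < r"
    "\<And>g. g \<in> mspace homeo_cube \<Longrightarrow> mdist homeo_cube f g < r \<Longrightarrow> g \<in> T"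
    unfolding openin_mtopology_of by blast
  fix a :: 'n
  \<comment> \<open>\<open>N\<close> controls the distance from f, \<open>M\<close> the measure lost
    over the steps; the successors guarantee positivity.\<close>
  obtain N' M' :: nat where "1 / real (Suc N') < r" "1 / real (Suc M') < e"
    using r(1) assms nat_approx_posE by metis
  then obtain N M :: nat where NM: "0 < N" "0 < M" "1 / real N < r" "1 / real M < e"
    using zero_less_Suc by blast
  have fcube: "f x \<in> unit_cube" if "x \<in> unit_cube" for x
    using homeo_cube_props(2)[OF f] that by blast
  have "continuous_on unit_cube (\<lambda>x. f x $ a)"
    by (intro continuous_intros homeo_cube_props(1)[OF f])
  then obtain k where k: "k < M" "compact (unit_cube \<inter> (\<lambda>x. f x $ a) -` off_steps N M k)"
    "measure lborel (unit_cube - (\<lambda>x. f x $ a) -` off_steps N M k) \<le> 1 / real M"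
    using exists_small_steps[OF _ NM(2), of _ N] by blast
  define K where "K = unit_cube \<inter> (\<lambda>x. f x $ a) -` off_steps N M k"
  have "unit_cube - K = unit_cube - (\<lambda>x. f x $ a) -` off_steps N M k"
    by (auto simp: K_def)
  then have K: "compact K" "K \<subseteq> unit_cube" "measure lborel (unit_cube - K) < e"
    using k(2,3) NM(4) by (auto simp: K_def)
  \<comment> \<open>Chosen after \<open>N\<close>: the \<open>N + 1\<close> covering slabs of width
    \<open>w\<close> have total width at most e/2, and the bound 1/2 keeps \<open>1 - w\<close>
    positive.\<close>
  define w where "w = min (1/2) (e / (2 * real (N + 1)))"
  have w: "0 < w" "w < 1" "real (N + 1) * w < e"
  proof -
    show "0 < w" "w < 1"
      using assms by (auto simp: w_def)
    have "real (N + 1) * w \<le> real (N + 1) * (e / (2 * real (N + 1)))"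
      by (intro mult_left_mono) (auto simp: w_def)
    also have "\<dots> = e / 2"
      by (simp add: field_simps)
    finally show "real (N + 1) * w < e"
      using assms by simp
  qed
  \<comment> \<open>The staircase alone is not injective in general; the linear term makes the
    convex combination strictly increasing, while both ends stay fixed.\<close>
  define h where "h t = w * t + (1 - w) * stair N M k t" for t
  have h: "continuous_on {0..1} h" "strict_mono_on {0..1} h" "h 0 = 0" "h 1 = 1"
  proof -
    show "continuous_on {0..1} h"
      unfolding h_def by (intro continuous_intros)
    show "strict_mono_on {0..1} h"
      unfolding h_def using w
      by (intro strict_mono_onI add_less_le_mono mult_strict_left_mono mult_left_mono stair_mono) auto
    show "h 0 = 0" "h 1 = 1"
      using NM k by (auto simp: h_def stair_0 stair_1)
  qed
  have h_near: "\<bar>h t - t\<bar> < r" if "0 \<le> t" "t \<le> 1" for t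
  proof -
    have "h t - t = (1 - w) * (stair N M k t - t)"
      by (simp add: h_def algebra_simps)
    then have "\<bar>h t - t\<bar> = (1 - w) * \<bar>stair N M k t - t\<bar>"
      using w by (simp add: abs_mult)
    also have "\<dots> \<le> 1 * (1 / real N)"
      using w stair_near[OF NM(1) k(1) that] by (intro mult_mono) auto
    finally show ?thesis
      using NM by simp
  qed
  define H where "H y = (\<chi> i. if i = a then h (y $ a) else y $ i)" for y :: "real^'n"
  define g where "g = restrict (H \<circ> f) unit_cube"
  have "\<exists>H'. homeomorphism unit_cube unit_cube H H'"
    unfolding H_def by (rule homeomorphism_unit_cube_coordinate[OF h])
  then have g: "g \<in> mspace homeo_cube"
    using restrict_compose_homeo_cube[OF f] by (auto simp: g_def)
  have "mdist homeo_cube f g < r"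
  proof -
    \<comment> \<open>The distance is attained at some x, so the strict pointwise bound
      \<open>h_near\<close> suffices; only coordinate \<open>a\<close> differs there.\<close>
    obtain x where x: "x \<in> unit_cube" "mdist homeo_cube f g = dist (f x) (g x)"
      using mdist_homeo_cube[OF f g] by blast
    have "g x - f x = axis a (h (f x $ a) - f x $ a)"
      using x(1) by (simp add: g_def H_def vec_eq_iff axis_def)
    then have "dist (f x) (g x) = \<bar>h (f x $ a) - f x $ a\<bar>"
      by (simp add: dist_norm norm_minus_commute[of "f x" "g x"] norm_eq_sqrt_inner[of "axis _ _"] inner_axis_axis)
    then show ?thesis
      using x(2) h_near fcube[OF x(1)] by (simp add: mem_unit_cube)
  qed
  moreover have "measure lborel (g ` K) < e"
  proof -
    \<comment> \<open>On \<open>K\<close> the staircase takes a value j / N with 0 \<le> j \<le> N,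
      and the linear term adds between 0 and \<open>w\<close>. Hence \<open>N + 1\<close> slabs
      cover the image.\<close>
    let ?u = "\<lambda>j. (1 - w) * (real j / real N)"
    let ?B = "\<lambda>j. cbox (\<chi> i. if i = a then ?u j else 0) (\<chi> i. if i = a then ?u j + w else 1) :: (real^'n) set"
    have "\<exists>j\<le>N. g x \<in> ?B j" if "x \<in> K" for x
    proof -
      have x: "x \<in> unit_cube" and "f x $ a \<in> off_steps N M k"
        using that by (auto simp: K_def)
      then obtain j where j: "j \<le> N" "stair N M k (f x $ a) = real j / real N"
        using stair_off_steps by blast
      have "0 \<le> w * f x $ a" "w * f x $ a \<le> w"
        using w fcube[OF x] by (auto simp: mem_unit_cube mult_left_le)
      then have "?u j \<le> h (f x $ a)" "h (f x $ a) \<le> ?u j + w"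
        using j(2) by (auto simp: h_def)
      with fcube[OF x] x have "g x \<in> ?B j"
        by (simp add: g_def H_def mem_box_cart mem_unit_cube)
      with j(1) show ?thesis
        by blast
    qed
    then have "g ` K \<subseteq> (\<Union>j\<le>N. ?B j)"
      by blast
    then have "measure lborel (g ` K) \<le> measure lborel (\<Union>j\<le>N. ?B j)"
      using compact_image_homeo_cube[OF g K(1,2)]
      by (intro measure_mono_fmeasurable fmeasurable_compact compact_UN) (auto simp: borel_compact)
    also have "\<dots> \<le> (\<Sum>j\<le>N. measure lborel (?B j))"
      by (intro measure_UNION_le) auto
    also have "\<dots> \<le> (\<Sum>j\<le>N. w)"
      using w by (intro sum_mono measure_slab_le) auto
    also have "\<dots> = real (N + 1) * w"
      by simp
    finally show ?thesis
      using w by simp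
  qed
  then have "g \<in> nearly_singular e"
    using g K unfolding nearly_singular_def by blast
  ultimately show "nearly_singular e \<inter> T \<noteq> {}"
    using r(2)[OF g] by blast
qed

theorem theorem4p5:
  shows "comeager_in (mtopology_of homeo_cube)
           {f :: real^'n \<Rightarrow> real^'n. singular_homeo f}"
proof (rule comeager_inI)
  show "openin (mtopology_of homeo_cube) (nearly_singular ((1/2) ^ n) :: (real^'n \<Rightarrow> real^'n) set)" for n
    by (rule openin_nearly_singular)
  show "mtopology_of homeo_cube closure_of (nearly_singular ((1/2) ^ n) :: (real^'n \<Rightarrow> real^'n) set) =
      topspace (mtopology_of homeo_cube)" for n
    by (rule closure_of_nearly_singular) simp
  show "(\<Inter>n. nearly_singular ((1/2) ^ n)) \<subseteq> {f :: real^'n \<Rightarrow> real^'n. singular_homeo f}"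
    by (intro subsetI CollectI singular_homeo_if_nearly_singular) (rule INT_D[OF _ UNIV_I])
  show "{f :: real^'n \<Rightarrow> real^'n. singular_homeo f} \<subseteq> topspace (mtopology_of homeo_cube)"
    by (simp add: singular_homeo_def Collect_mono_iff subset_iff)
qed

end
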